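(* Let $I$ be a two-sided ideal of a ring $R$ (not necessarily unital). (i) If $R$ is purely infinite (respectively, properly purely infinite), then so is $R/I$. (ii) Assume that $I$ is s-unital. If $R$ is purely infinite (respectively, properly purely infinite), then so is $I$.
   Context: Rings are associative and not necessarily unital. A ring $R$ is s-unital if for each $x\in R$ there exist $u,v\in R$ with $ux=xv=x$. An ideal $I$ is s-unital if it is s-unital when viewed as a ring in its own right (so $u,v$ must lie in $I$). Statements that $I$ is (properly) purely infinite likewise refer to $I$ as a ring. For $a\in R$, $RaR$ denotes the set of finite sums $\sum_i r_ias_i$ with $r_i,s_i\in R$. A ring $R$ is purely infinite if (i) no quotient of $R$ is a division ring, and (ii) whenever $a\in R$ and $b\in RaR$, there exist $x,y\in R$ with $b=xay$. An element $a\in R$ is properly infinite if $a\neq 0$ and there exist $\alpha_1,\alpha_2,\beta_1,\beta_2\in R$ with $\alpha_i a\beta_j=\delta_{ij}a$ for all $i,j\in\{1,2\}$. A ring is properly purely infinite if every nonzero element of it is properly infinite. *)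

theory Defs
  imports "HOL-Algebra.QuotRing"
begin

text \<open>
  Not necessarily unital rings are carried by the ring records of HOL-Algebra, whose field
  \<^const>\<open>one\<close> is left unconstrained: no definition below depends on its value.
  In particular the quotient \<^term>\<open>R Quot I\<close> and the substructure
  \<^term>\<open>R\<lparr>carrier := I\<rparr>\<close> make sense, with a meaningless \<^const>\<open>one\<close>.
\<close>

locale nonunital_ring = abelian_group R for R (structure) +
  assumes mult_closed:
      "\<lbrakk>x \<in> carrier R; y \<in> carrier R\<rbrakk> \<Longrightarrow> x \<otimes> y \<in> carrier R"
    and mult_assoc:
      "\<lbrakk>x \<in> carrier R; y \<in> carrier R; z \<in> carrier R\<rbrakk> \<Longrightarrow> (x \<otimes> y) \<otimes> z = x \<otimes> (y \<otimes> z)"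
    and distrib_right:
      "\<lbrakk>x \<in> carrier R; y \<in> carrier R; z \<in> carrier R\<rbrakk> \<Longrightarrow> (x \<oplus> y) \<otimes> z = x \<otimes> z \<oplus> y \<otimes> z"
    and distrib_left:
      "\<lbrakk>x \<in> carrier R; y \<in> carrier R; z \<in> carrier R\<rbrakk> \<Longrightarrow> z \<otimes> (x \<oplus> y) = z \<otimes> x \<oplus> z \<otimes> y"

locale two_sided_ideal = additive_subgroup I R + nonunital_ring R for I and R (structure) +
  assumes mult_left_mem: "\<lbrakk>a \<in> I; x \<in> carrier R\<rbrakk> \<Longrightarrow> x \<otimes> a \<in> I"
    and mult_right_mem: "\<lbrakk>a \<in> I; x \<in> carrier R\<rbrakk> \<Longrightarrow> a \<otimes> x \<in> I"

text \<open>
  The identity of a division ring need not be the one recorded in the structure. The equation on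
  \<^const>\<open>Units\<close> is the one in the definition of \<^locale>\<open>field\<close>; it forces the identity to be nonzero.
\<close>

definition division_ring :: "('a, 'm) ring_scheme \<Rightarrow> bool" where
  "division_ring D \<longleftrightarrow>
     (\<exists>e \<in> carrier D. ring (D\<lparr>one := e\<rparr>) \<and> Units (D\<lparr>one := e\<rparr>) = carrier D - {\<zero>\<^bsub>D\<^esub>})"

definition s_unital :: "('a, 'm) ring_scheme \<Rightarrow> bool" where
  "s_unital R \<longleftrightarrow> nonunital_ring R \<and>
     (\<forall>x \<in> carrier R. \<exists>u \<in> carrier R. \<exists>v \<in> carrier R. u \<otimes>\<^bsub>R\<^esub> x = x \<and> x \<otimes>\<^bsub>R\<^esub> v = x)"

text \<open>The set $RaR$ of finite sums $\sum_i r_i a s_i$.\<close>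

definition RaR :: "('a, 'm) ring_scheme \<Rightarrow> 'a \<Rightarrow> 'a set" where
  "RaR R a = {\<Oplus>\<^bsub>R\<^esub>i\<in>{..<n}. r i \<otimes>\<^bsub>R\<^esub> a \<otimes>\<^bsub>R\<^esub> s i | (n :: nat) r s.
     r \<in> {..<n} \<rightarrow> carrier R \<and> s \<in> {..<n} \<rightarrow> carrier R}"

definition purely_infinite :: "('a, 'm) ring_scheme \<Rightarrow> bool" where
  "purely_infinite R \<longleftrightarrow> nonunital_ring R \<and>
     (\<forall>J. two_sided_ideal J R \<longrightarrow> \<not> division_ring (R Quot J)) \<and>
     (\<forall>a \<in> carrier R. \<forall>b \<in> RaR R a. \<exists>x \<in> carrier R. \<exists>y \<in> carrier R. b = x \<otimes>\<^bsub>R\<^esub> a \<otimes>\<^bsub>R\<^esub> y)"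

definition properly_infinite :: "('a, 'm) ring_scheme \<Rightarrow> 'a \<Rightarrow> bool" where
  "properly_infinite R a \<longleftrightarrow> a \<in> carrier R \<and> a \<noteq> \<zero>\<^bsub>R\<^esub> \<and>
     (\<exists>\<alpha> \<beta>. \<alpha> \<in> {1, 2 :: nat} \<rightarrow> carrier R \<and> \<beta> \<in> {1, 2 :: nat} \<rightarrow> carrier R \<and>
       (\<forall>i \<in> {1, 2}. \<forall>j \<in> {1, 2}.
          \<alpha> i \<otimes>\<^bsub>R\<^esub> a \<otimes>\<^bsub>R\<^esub> \<beta> j = (if i = j then a else \<zero>\<^bsub>R\<^esub>)))"

definition properly_purely_infinite :: "('a, 'm) ring_scheme \<Rightarrow> bool" where
  "properly_purely_infinite R \<longleftrightarrow> nonunital_ring R \<and>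
     (\<forall>a \<in> carrier R - {\<zero>\<^bsub>R\<^esub>}. properly_infinite R a)"

end

theory Submission
  imports Defs
begin

text \<open>
  Both properties pass to quotients because they are given by equations between elements, which
  survive a surjective homomorphism: a sum in $SbS$ lifts to a sum in $RaR$ once its coefficients
  are lifted, and a quotient of the image is, up to isomorphism, a quotient of $R$.

  For an s-unital ideal $I$ the equations are solved in $R$ first. If $ua = a = av$ with
  $u, v \<in> I$, then $xay = (xu)a(vy)$, so the multipliers $x, y \<in> R$ can be moved into $I$
  (\<open>absorb_local_units\<close>). The only delicate point is that no quotient $I/J$ is a division ring.
  Local units make $J$ an ideal of $R$ as well (\<open>ideal_of_ideal\<close>). If $I/J$ were a division ring
  with identity $e + J$, then $e$ would be an idempotent modulo $J$ that commutes with $R$ modulo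
  $J$, and $r \<mapsto> re + J$ would be a ring homomorphism from $R$ onto $I/J$. Its kernel is the
  residual \<open>K = {r. rI \<subseteq> J}\<close>, a description that does not mention $e$, and $R/K$ would be a
  division ring, against the hypothesis on $R$ (\<open>division_modulo_residual\<close>).

  To compare division rings along homomorphisms and ideals without building isomorphisms between
  iterated quotients, the condition that $R/K$ is a division ring is restated on elements of $R$:
  $K$ is proper, and $ax \<equiv> b$ and $ya \<equiv> b$ are solvable modulo $K$ for every $a \<notin> K$ and every $b$
  (\<open>division_ring_quotient_iff\<close>).
\<close>

section \<open>Rings without identity and cosets of their ideals\<close>

context nonunital_ring
begin

lemma mult_zero_left:
  assumes "x \<in> carrier R" shows "\<zero> \<otimes> x = \<zero>"
proof -
  have "\<zero> \<otimes> x \<oplus> \<zero> \<otimes> x = \<zero> \<otimes> x"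
    using distrib_right[of \<zero> \<zero> x] assms by simp
  then show ?thesis using assms by (simp add: mult_closed)
qed

lemma mult_zero_right:
  assumes "x \<in> carrier R" shows "x \<otimes> \<zero> = \<zero>"
proof -
  have "x \<otimes> \<zero> \<oplus> x \<otimes> \<zero> = x \<otimes> \<zero>"
    using distrib_left[of \<zero> \<zero> x] assms by simp
  then show ?thesis using assms by (simp add: mult_closed)
qed

lemma mult_minus_left:
  assumes "x \<in> carrier R" "y \<in> carrier R" shows "(\<ominus> x) \<otimes> y = \<ominus> (x \<otimes> y)"
proof (rule sym, rule minus_equality)
  show "(\<ominus> x) \<otimes> y \<oplus> x \<otimes> y = \<zero>"
    using distrib_right[of "\<ominus> x" x y] assms by (simp add: l_neg mult_zero_left)
qed (use assms in \<open>auto simp: mult_closed\<close>)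

lemma diff_mult:
  "\<lbrakk>x \<in> carrier R; y \<in> carrier R; z \<in> carrier R\<rbrakk> \<Longrightarrow> (x \<ominus> y) \<otimes> z = x \<otimes> z \<ominus> y \<otimes> z"
  by (simp add: a_minus_def distrib_right mult_minus_left)

lemma two_sided_idealI:
  assumes "J \<subseteq> carrier R" "\<zero> \<in> J"
    and "\<And>a b. \<lbrakk>a \<in> J; b \<in> J\<rbrakk> \<Longrightarrow> a \<oplus> b \<in> J"
    and "\<And>a. a \<in> J \<Longrightarrow> \<ominus> a \<in> J"
    and "\<And>a x. \<lbrakk>a \<in> J; x \<in> carrier R\<rbrakk> \<Longrightarrow> x \<otimes> a \<in> J"
    and "\<And>a x. \<lbrakk>a \<in> J; x \<in> carrier R\<rbrakk> \<Longrightarrow> a \<otimes> x \<in> J"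
  shows "two_sided_ideal J R"
proof (intro two_sided_ideal.intro two_sided_ideal_axioms.intro additive_subgroupI
    nonunital_ring_axioms)
  show "subgroup J (add_monoid R)"
    by (rule add.subgroupI) (use assms(1-4) in auto)
qed (rule assms; assumption)+

lemma trivial_ideal: "two_sided_ideal {\<zero>} R"
  by (rule two_sided_idealI) (auto simp: mult_zero_left mult_zero_right)

end

sublocale two_sided_ideal \<subseteq> abelian_subgroup I R
  by (intro abelian_subgroupI3 additive_subgroup_axioms abelian_group_axioms)

context two_sided_ideal
begin

lemma coset_eq_iff:
  assumes "x \<in> carrier R" "y \<in> carrier R"
  shows "I +> x = I +> y \<longleftrightarrow> x \<ominus> y \<in> I"
  using a_rcos_module[OF assms(2,1)] a_repr_independence'[of x y] a_repr_independenceD[of x y] assms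
  unfolding a_minus_def by metis

lemma coset_eq_self_iff: "x \<in> carrier R \<Longrightarrow> I +> x = I \<longleftrightarrow> x \<in> I"
  using a_coset_join1 a_coset_join2 a_subgroup by blast

lemma coset_mult_left:
  assumes "I +> x = I +> y" "x \<in> carrier R" "y \<in> carrier R" "z \<in> carrier R"
  shows "I +> (z \<otimes> x) = I +> (z \<otimes> y)"
proof -
  obtain i where "i \<in> I" "x = i \<oplus> y"
    using a_rcos_self[OF assms(2)] assms(1) by (auto simp: a_r_coset_def')
  then have "z \<otimes> x = z \<otimes> i \<oplus> z \<otimes> y" "z \<otimes> i \<in> I"
    using assms by (auto simp: distrib_left mult_left_mem)
  then have "z \<otimes> x \<in> I +> (z \<otimes> y)" by (auto simp: a_r_coset_def')
  then show ?thesis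
    using a_repr_independence'[symmetric] assms(3,4) by (simp add: mult_closed)
qed

lemma coset_mult_right:
  assumes "I +> x = I +> y" "x \<in> carrier R" "y \<in> carrier R" "z \<in> carrier R"
  shows "I +> (x \<otimes> z) = I +> (y \<otimes> z)"
proof -
  obtain i where "i \<in> I" "x = i \<oplus> y"
    using a_rcos_self[OF assms(2)] assms(1) by (auto simp: a_r_coset_def')
  then have "x \<otimes> z = i \<otimes> z \<oplus> y \<otimes> z" "i \<otimes> z \<in> I"
    using assms by (auto simp: distrib_right mult_right_mem)
  then have "x \<otimes> z \<in> I +> (y \<otimes> z)" by (auto simp: a_r_coset_def')
  then show ?thesis
    using a_repr_independence'[symmetric] assms(3,4) by (simp add: mult_closed)
qed

text \<open>
  The product of two cosets is a union over all representatives; it is a single coset because every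
  pair of representatives gives the same one.
\<close>

lemma rcoset_mult_coset:
  assumes x: "x \<in> carrier R" and y: "y \<in> carrier R"
  shows "[mod I:] (I +> x) \<Otimes> (I +> y) = I +> (x \<otimes> y)"
proof -
  have "I +> (x' \<otimes> y') = I +> (x \<otimes> y)" if "x' \<in> I +> x" "y' \<in> I +> y" for x' y'
  proof -
    have c: "x' \<in> carrier R" "y' \<in> carrier R"
      using a_elemrcos_carrier[OF x that(1)] a_elemrcos_carrier[OF y that(2)] by simp_all
    have "I +> (x' \<otimes> y') = I +> (x \<otimes> y')"
      by (rule coset_mult_right[OF a_repr_independence'[OF that(1) x, symmetric] c(1) x c(2)])
    also have "\<dots> = I +> (x \<otimes> y)"
      by (rule coset_mult_left[OF a_repr_independence'[OF that(2) y, symmetric] c(2) y x])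
    finally show ?thesis .
  qed
  then have "[mod I:] (I +> x) \<Otimes> (I +> y) = (\<Union>x' \<in> I +> x. \<Union>y' \<in> I +> y. I +> (x \<otimes> y))"
    unfolding rcoset_mult_def by (intro SUP_cong refl)
  moreover have "I +> x \<noteq> {}" "I +> y \<noteq> {}"
    using a_rcos_self x y by blast+
  ultimately show ?thesis by simp
qed

lemma quotient_nonunital_ring: "nonunital_ring (R Quot I)"
proof (intro nonunital_ring.intro nonunital_ring_axioms.intro)
  show "abelian_group (R Quot I)"
    by (rule comm_group_abelian_groupI)
      (simp add: FactRing_def a_factorgroup_is_comm_group[unfolded A_FactGroup_def'])
qed (auto simp: FactRing_simps rcoset_mult_coset a_rcos_sum mult_closed mult_assoc
    distrib_left distrib_right)

end

section \<open>Homomorphisms\<close>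

locale nonunital_ring_hom =
  R?: nonunital_ring R + S?: nonunital_ring S + abelian_group_hom R S h
  for R (structure) and S (structure) and h +
  assumes hom_mult:
    "\<lbrakk>x \<in> carrier R; y \<in> carrier R\<rbrakk> \<Longrightarrow> h (x \<otimes>\<^bsub>R\<^esub> y) = h x \<otimes>\<^bsub>S\<^esub> h y"

lemma nonunital_ring_homI:
  assumes "nonunital_ring R" "nonunital_ring S"
    and closed: "\<And>x. x \<in> carrier R \<Longrightarrow> h x \<in> carrier S"
    and add: "\<And>x y. \<lbrakk>x \<in> carrier R; y \<in> carrier R\<rbrakk> \<Longrightarrow> h (x \<oplus>\<^bsub>R\<^esub> y) = h x \<oplus>\<^bsub>S\<^esub> h y"
    and mult: "\<And>x y. \<lbrakk>x \<in> carrier R; y \<in> carrier R\<rbrakk> \<Longrightarrow> h (x \<otimes>\<^bsub>R\<^esub> y) = h x \<otimes>\<^bsub>S\<^esub> h y"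
  shows "nonunital_ring_hom R S h"
proof -
  interpret R: nonunital_ring R by fact
  interpret S: nonunital_ring S by fact
  have "group_hom (add_monoid R) (add_monoid S) h"
    using closed add
    by (auto simp: group_hom_def group_hom_axioms_def hom_def R.a_group S.a_group)
  then show ?thesis
    by (intro nonunital_ring_hom.intro nonunital_ring_hom_axioms.intro abelian_group_homI
        R.abelian_group_axioms S.abelian_group_axioms assms)
qed

lemma RaR_memI:
  assumes "r \<in> {..<n::nat} \<rightarrow> carrier R" "s \<in> {..<n} \<rightarrow> carrier R"
  shows "(\<Oplus>\<^bsub>R\<^esub>i\<in>{..<n}. r i \<otimes>\<^bsub>R\<^esub> a \<otimes>\<^bsub>R\<^esub> s i) \<in> RaR R a"
  unfolding RaR_def using assms by blast

lemma RaR_memE: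
  assumes "b \<in> RaR R a"
  obtains n :: nat and r s where "b = (\<Oplus>\<^bsub>R\<^esub>i\<in>{..<n}. r i \<otimes>\<^bsub>R\<^esub> a \<otimes>\<^bsub>R\<^esub> s i)"
    "r \<in> {..<n} \<rightarrow> carrier R" "s \<in> {..<n} \<rightarrow> carrier R"
  using assms unfolding RaR_def by blast

lemma (in two_sided_ideal) coset_hom: "nonunital_ring_hom R (R Quot I) ((+>) I)"
  by (rule nonunital_ring_homI[OF nonunital_ring_axioms quotient_nonunital_ring])
    (auto simp: FactRing_simps rcoset_mult_coset a_rcos_sum)

lemma coset_image: "(+>\<^bsub>R\<^esub>) I ` carrier R = carrier (R Quot I)"
  by (auto simp: FactRing_simps)

context nonunital_ring_hom
begin

lemma hom_finsum:
  assumes "f \<in> A \<rightarrow> carrier R"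
  shows "h (finsum R f A) = finsum S (\<lambda>i. h (f i)) A"
  using assms
proof (induction A rule: infinite_finite_induct)
  case (insert a A)
  then show ?case by (simp add: Pi_def)
qed auto

lemma hom_RaR_sum:
  assumes "a \<in> carrier R" "r \<in> {..<n::nat} \<rightarrow> carrier R" "s \<in> {..<n} \<rightarrow> carrier R"
  shows "h (\<Oplus>\<^bsub>R\<^esub>i\<in>{..<n}. r i \<otimes>\<^bsub>R\<^esub> a \<otimes>\<^bsub>R\<^esub> s i) =
    (\<Oplus>\<^bsub>S\<^esub>i\<in>{..<n}. h (r i) \<otimes>\<^bsub>S\<^esub> h a \<otimes>\<^bsub>S\<^esub> h (s i))"
proof -
  have "h (\<Oplus>\<^bsub>R\<^esub>i\<in>{..<n}. r i \<otimes>\<^bsub>R\<^esub> a \<otimes>\<^bsub>R\<^esub> s i) =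
    (\<Oplus>\<^bsub>S\<^esub>i\<in>{..<n}. h (r i \<otimes>\<^bsub>R\<^esub> a \<otimes>\<^bsub>R\<^esub> s i))"
    using assms by (intro hom_finsum) (auto intro!: R.mult_closed)
  also have "\<dots> = (\<Oplus>\<^bsub>S\<^esub>i\<in>{..<n}. h (r i) \<otimes>\<^bsub>S\<^esub> h a \<otimes>\<^bsub>S\<^esub> h (s i))"
    using assms by (intro S.finsum_cong') (auto simp: Pi_iff R.mult_closed S.mult_closed hom_mult)
  finally show ?thesis .
qed

lemma hom_RaR:
  assumes a: "a \<in> carrier R" and b: "b \<in> RaR R a"
  shows "h b \<in> RaR S (h a)"
  using b
proof (rule RaR_memE)
  fix n :: nat and r s
  assume "b = (\<Oplus>\<^bsub>R\<^esub>i\<in>{..<n}. r i \<otimes>\<^bsub>R\<^esub> a \<otimes>\<^bsub>R\<^esub> s i)"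
    and rs: "r \<in> {..<n} \<rightarrow> carrier R" "s \<in> {..<n} \<rightarrow> carrier R"
  then have "h b = (\<Oplus>\<^bsub>S\<^esub>i\<in>{..<n}. h (r i) \<otimes>\<^bsub>S\<^esub> h a \<otimes>\<^bsub>S\<^esub> h (s i))"
    using hom_RaR_sum[OF a] by simp
  also have "\<dots> \<in> RaR S (h a)"
    by (rule RaR_memI) (use rs in \<open>auto simp: Pi_iff\<close>)
  finally show ?thesis .
qed

text \<open>
  Choosing preimages of the coefficients lifts a finite sum term by term.
\<close>

lemma RaR_surj_image:
  assumes surj: "h ` carrier R = carrier S" and a: "a \<in> carrier R" and b: "b \<in> RaR S (h a)"
  obtains b' where "b' \<in> RaR R a" "b = h b'"
proof -
  obtain n :: nat and r s where b_eq: "b = (\<Oplus>\<^bsub>S\<^esub>i\<in>{..<n}. r i \<otimes>\<^bsub>S\<^esub> h a \<otimes>\<^bsub>S\<^esub> s i)"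
    and rs: "r \<in> {..<n} \<rightarrow> carrier S" "s \<in> {..<n} \<rightarrow> carrier S"
    using b by (rule RaR_memE)
  define g where "g = inv_into (carrier R) h"
  have g: "g y \<in> carrier R \<and> h (g y) = y" if "y \<in> carrier S" for y
    using that surj unfolding g_def by (metis f_inv_into_f inv_into_into)
  have "h (\<Oplus>\<^bsub>R\<^esub>i\<in>{..<n}. g (r i) \<otimes>\<^bsub>R\<^esub> a \<otimes>\<^bsub>R\<^esub> g (s i)) = b"
    unfolding b_eq using rs g a
    by (subst hom_RaR_sum) (auto simp: Pi_iff intro!: S.finsum_cong' S.mult_closed)
  moreover have "(\<Oplus>\<^bsub>R\<^esub>i\<in>{..<n}. g (r i) \<otimes>\<^bsub>R\<^esub> a \<otimes>\<^bsub>R\<^esub> g (s i)) \<in> RaR R a"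
    by (rule RaR_memI) (use rs g in \<open>auto simp: Pi_iff\<close>)
  ultimately show thesis using that by blast
qed

lemma preimage_ideal:
  assumes "two_sided_ideal J S"
  shows "two_sided_ideal {x \<in> carrier R. h x \<in> J} R"
proof -
  interpret J: two_sided_ideal J S by fact
  show ?thesis
    by (rule R.two_sided_idealI)
      (auto simp: hom_mult R.mult_closed J.mult_left_mem J.mult_right_mem)
qed

end

section \<open>Quotients that are division rings\<close>

text \<open>
  The classical axioms for a division ring by solvability of linear equations, read modulo $K$.
  Cosets rather than differences express the congruences, so that they are equalities and chain
  by transitivity; the coset of an element is also the same set in $R$ and in an ideal of $R$
  that contains $K$.
\<close>

definition division_modulo :: "('a, 'm) ring_scheme \<Rightarrow> 'a set \<Rightarrow> bool" where
  "division_modulo R K \<longleftrightarrow> \<not> carrier R \<subseteq> K \<and>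
     (\<forall>a \<in> carrier R - K. \<forall>b \<in> carrier R.
        (\<exists>x \<in> carrier R. K +>\<^bsub>R\<^esub> (a \<otimes>\<^bsub>R\<^esub> x) = K +>\<^bsub>R\<^esub> b) \<and>
        (\<exists>y \<in> carrier R. K +>\<^bsub>R\<^esub> (y \<otimes>\<^bsub>R\<^esub> a) = K +>\<^bsub>R\<^esub> b))"

text \<open>
  Fix $a \<notin> I$ and solve $ae \<equiv> a$. Every $b$ has the form $ya$ modulo $I$, so $be \<equiv> yae \<equiv> ya \<equiv> b$, and
  $e$ is a right identity. Symmetrically, $fa \<equiv> a$ gives a left identity $f$, and the two agree
  because $e \<equiv> fe \<equiv> f$.
\<close>

lemma (in two_sided_ideal) division_modulo_identity:
  assumes "division_modulo R I"
  obtains e where "e \<in> carrier R" "e \<notin> I"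
    "\<And>b. b \<in> carrier R \<Longrightarrow> I +> (b \<otimes> e) = I +> b"
    "\<And>b. b \<in> carrier R \<Longrightarrow> I +> (e \<otimes> b) = I +> b"
proof -
  note div = assms[unfolded division_modulo_def]
  obtain a where a: "a \<in> carrier R" "a \<notin> I" using div by blast
  obtain e where e: "e \<in> carrier R" "I +> (a \<otimes> e) = I +> a" using div a by blast
  obtain f where f: "f \<in> carrier R" "I +> (f \<otimes> a) = I +> a" using div a by blast
  have right: "I +> (b \<otimes> e) = I +> b" if b: "b \<in> carrier R" for b
  proof -
    obtain y where y: "y \<in> carrier R" "I +> (y \<otimes> a) = I +> b" using div a b by blast
    have "I +> (b \<otimes> e) = I +> (y \<otimes> a \<otimes> e)"
      by (rule coset_mult_right[OF y(2)[symmetric] b _ e(1)]) (use y a in \<open>simp add: mult_closed\<close>)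
    also have "\<dots> = I +> (y \<otimes> a)"
      using coset_mult_left[OF e(2) _ _ y(1)] a(1) y(1) e(1) by (simp add: mult_closed mult_assoc)
    finally show ?thesis using y(2) by simp
  qed
  have left: "I +> (f \<otimes> b) = I +> b" if b: "b \<in> carrier R" for b
  proof -
    obtain x where x: "x \<in> carrier R" "I +> (a \<otimes> x) = I +> b" using div a b by blast
    have "I +> (f \<otimes> b) = I +> (f \<otimes> (a \<otimes> x))"
      by (rule coset_mult_left[OF x(2)[symmetric] b _ f(1)]) (use x a in \<open>simp add: mult_closed\<close>)
    also have "\<dots> = I +> (a \<otimes> x)"
      using coset_mult_right[OF f(2) _ _ x(1)] a(1) x(1) f(1) by (simp add: mult_closed mult_assoc)
    finally show ?thesis using x(2) by simp
  qed
  have "I +> e = I +> f" by (rule trans[OF left[OF e(1), symmetric] right[OF f(1)]])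
  then have "I +> (e \<otimes> b) = I +> b" if "b \<in> carrier R" for b
    using coset_mult_right[OF _ e(1) f(1) that] left[OF that] by simp
  moreover have "e \<notin> I"
  proof
    assume "e \<in> I"
    then have "I +> (a \<otimes> e) = I"
      using a(1) e(1) by (simp add: mult_left_mem coset_eq_self_iff mult_closed)
    then show False using a e(2) by (simp add: coset_eq_self_iff)
  qed
  ultimately show thesis using that e right by blast
qed

lemma division_ring_iff_division_modulo_zero:
  fixes D (structure)
  assumes "nonunital_ring D"
  shows "division_ring D \<longleftrightarrow> division_modulo D {\<zero>}"
proof -
  interpret nonunital_ring D by fact
  interpret Z: two_sided_ideal "{\<zero>}" D by (rule trivial_ideal)
  have coset_zero: "{\<zero>} +> a = {\<zero>} +> b \<longleftrightarrow> a = b"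
    if "a \<in> carrier D" "b \<in> carrier D" for a b
    using that by (simp add: a_r_coset_def')
  show ?thesis
  proof
    assume "division_ring D"
    then obtain e where e: "e \<in> carrier D" and ring: "ring (D\<lparr>one := e\<rparr>)"
      and units: "Units (D\<lparr>one := e\<rparr>) = carrier D - {\<zero>}"
      unfolding division_ring_def by blast
    interpret E: ring "D\<lparr>one := e\<rparr>" by (rule ring)
    have one: "e \<otimes> b = b" "b \<otimes> e = b" if "b \<in> carrier D" for b
      using E.l_one[of b] E.r_one[of b] that by simp_all
    have "e \<in> carrier D - {\<zero>}"
      using E.Units_one_closed units by simp
    moreover have "\<exists>x \<in> carrier D. a \<otimes> x = b" "\<exists>y \<in> carrier D. y \<otimes> a = b"
      if a: "a \<in> carrier D - {\<zero>}" and b: "b \<in> carrier D" for a b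
    proof -
      obtain c where c: "c \<in> carrier D" "c \<otimes> a = e" "a \<otimes> c = e"
        using a[folded units] by (auto simp: Units_def)
      have "a \<otimes> (c \<otimes> b) = b" "b \<otimes> c \<otimes> a = b"
        using mult_assoc[of a c b] mult_assoc[of b c a] a b c one by simp_all
      moreover have "c \<otimes> b \<in> carrier D" "b \<otimes> c \<in> carrier D"
        using b c by (simp_all add: mult_closed)
      ultimately show "\<exists>x \<in> carrier D. a \<otimes> x = b" "\<exists>y \<in> carrier D. y \<otimes> a = b"
        by blast+
    qed
    ultimately show "division_modulo D {\<zero>}"
      unfolding division_modulo_def by (auto simp: coset_zero mult_closed)
  next
    assume div: "division_modulo D {\<zero>}"
    then obtain e where e: "e \<in> carrier D" "e \<noteq> \<zero>"
      and one: "\<And>b. b \<in> carrier D \<Longrightarrow> b \<otimes> e = b" "\<And>b. b \<in> carrier D \<Longrightarrow> e \<otimes> b = b"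
      by (rule Z.division_modulo_identity) (auto simp: coset_zero mult_closed)
    have "abelian_group (D\<lparr>one := e\<rparr>)"
      using abelian_group_axioms
      by (simp add: abelian_group_def abelian_monoid_def abelian_group_axioms_def)
    then have "ring (D\<lparr>one := e\<rparr>)"
      by (intro ringI monoidI)
        (use e one in \<open>auto simp: mult_closed mult_assoc distrib_left distrib_right\<close>)
    moreover have "Units (D\<lparr>one := e\<rparr>) = carrier D - {\<zero>}"
    proof (intro equalityI subsetI)
      fix a assume "a \<in> Units (D\<lparr>one := e\<rparr>)"
      then show "a \<in> carrier D - {\<zero>}"
        using e by (auto simp: Units_def mult_zero_left)
    next
      fix a assume a: "a \<in> carrier D - {\<zero>}"
      obtain x where x: "x \<in> carrier D" "a \<otimes> x = e"
        using div a e(1) by (auto simp: division_modulo_def coset_zero mult_closed)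
      obtain y where y: "y \<in> carrier D" "y \<otimes> a = e"
        using div a e(1) by (auto simp: division_modulo_def coset_zero mult_closed)
      \<comment> \<open>A left and a right inverse coincide: $y = y(ax) = (ya)x = x$.\<close>
      have "x = y" using mult_assoc[of y a x] a x y one by simp
      then show "a \<in> Units (D\<lparr>one := e\<rparr>)"
        using a x y by (auto simp: Units_def)
    qed
    ultimately show "division_ring D"
      using e unfolding division_ring_def by blast
  qed
qed

lemma (in nonunital_ring_hom) division_modulo_preimage:
  assumes surj: "h ` carrier R = carrier S" and J: "two_sided_ideal J S"
  shows "division_modulo R {x \<in> carrier R. h x \<in> J} \<longleftrightarrow> division_modulo S J"
proof -
  interpret J: two_sided_ideal J S by fact
  (* K is opaque: unfolded, the simplification rule "x in K implies x in carrier R" would loop. *)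
  define K where "K = {x \<in> carrier R. h x \<in> J}"
  interpret K: two_sided_ideal K R unfolding K_def by (rule preimage_ideal[OF J])
  have mem: "x \<in> K \<longleftrightarrow> h x \<in> J" if "x \<in> carrier R" for x
    using that unfolding K_def by blast
  have coset: "K +>\<^bsub>R\<^esub> x = K +>\<^bsub>R\<^esub> y \<longleftrightarrow> J +>\<^bsub>S\<^esub> h x = J +>\<^bsub>S\<^esub> h y"
    if "x \<in> carrier R" "y \<in> carrier R" for x y
  proof -
    have "x \<ominus>\<^bsub>R\<^esub> y \<in> carrier R" "h (x \<ominus>\<^bsub>R\<^esub> y) = h x \<ominus>\<^bsub>S\<^esub> h y"
      using that by (simp_all add: a_minus_def)
    then show ?thesis
      unfolding K.coset_eq_iff[OF that] J.coset_eq_iff[OF hom_closed[OF that(1)] hom_closed[OF that(2)]]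
      by (simp add: mem)
  qed
  have carrier: "carrier S = h ` carrier R" using surj by simp
  show ?thesis
    unfolding division_modulo_def carrier K_def[symmetric]
    by (auto simp: mem coset R.mult_closed hom_mult subset_iff)
qed

text \<open>
  The zero ideal of the quotient pulls back to $I$ along the coset map, so the criterion for the
  quotient modulo zero is the criterion for $R$ modulo $I$.
\<close>

lemma (in two_sided_ideal) division_ring_quotient_iff:
  "division_ring (R Quot I) \<longleftrightarrow> division_modulo R I"
proof -
  interpret h: nonunital_ring_hom R "R Quot I" "(+>) I" by (rule coset_hom)
  have zero: "\<zero>\<^bsub>R Quot I\<^esub> = I" by (simp add: FactRing_def)
  have "{x \<in> carrier R. I +> x \<in> {\<zero>\<^bsub>R Quot I\<^esub>}} = I"
    unfolding zero using a_subset coset_eq_self_iff by blast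
  then show ?thesis
    using division_ring_iff_division_modulo_zero[OF quotient_nonunital_ring]
      h.division_modulo_preimage[OF coset_image h.S.trivial_ideal]
    by simp
qed

section \<open>Homomorphic images\<close>

context nonunital_ring_hom
begin

lemma purely_infinite_image:
  assumes surj: "h ` carrier R = carrier S" and R: "purely_infinite R"
  shows "purely_infinite S"
  unfolding purely_infinite_def
proof (intro conjI allI impI ballI)
  fix J assume J: "two_sided_ideal J S"
  let ?K = "{x \<in> carrier R. h x \<in> J}"
  have K: "two_sided_ideal ?K R" by (rule preimage_ideal[OF J])
  have "\<not> division_ring (R Quot ?K)" using R K unfolding purely_infinite_def by blast
  then show "\<not> division_ring (S Quot J)"
    using division_modulo_preimage[OF surj J] two_sided_ideal.division_ring_quotient_iff[OF J]
      two_sided_ideal.division_ring_quotient_iff[OF K]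
    by blast
next
  fix a b assume "a \<in> carrier S" and b: "b \<in> RaR S a"
  then obtain a' where a': "a' \<in> carrier R" "a = h a'" using surj by blast
  then obtain b' where b': "b' \<in> RaR R a'" "b = h b'"
    using RaR_surj_image[OF surj] b by blast
  then obtain x y where "x \<in> carrier R" "y \<in> carrier R" "b' = x \<otimes>\<^bsub>R\<^esub> a' \<otimes>\<^bsub>R\<^esub> y"
    using R a' unfolding purely_infinite_def by blast
  then have "h x \<in> carrier S" "h y \<in> carrier S" "b = h x \<otimes>\<^bsub>S\<^esub> a \<otimes>\<^bsub>S\<^esub> h y"
    using a' b' by (auto simp: hom_mult R.mult_closed)
  then show "\<exists>x \<in> carrier S. \<exists>y \<in> carrier S. b = x \<otimes>\<^bsub>S\<^esub> a \<otimes>\<^bsub>S\<^esub> y" by blast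
qed (rule S.nonunital_ring_axioms)

lemma properly_purely_infinite_image:
  assumes surj: "h ` carrier R = carrier S" and R: "properly_purely_infinite R"
  shows "properly_purely_infinite S"
  unfolding properly_purely_infinite_def
proof (intro conjI ballI)
  fix a assume a: "a \<in> carrier S - {\<zero>\<^bsub>S\<^esub>}"
  then obtain a' where a': "a' \<in> carrier R" "a = h a'" using surj by blast
  then have "properly_infinite R a'"
    using R a unfolding properly_purely_infinite_def by auto
  then obtain \<alpha> \<beta> where ab: "\<alpha> \<in> {1, 2 :: nat} \<rightarrow> carrier R" "\<beta> \<in> {1, 2 :: nat} \<rightarrow> carrier R"
    and eq: "\<And>i j. \<lbrakk>i \<in> {1, 2}; j \<in> {1, 2}\<rbrakk> \<Longrightarrow>
      \<alpha> i \<otimes>\<^bsub>R\<^esub> a' \<otimes>\<^bsub>R\<^esub> \<beta> j = (if i = j then a' else \<zero>\<^bsub>R\<^esub>)"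
    unfolding properly_infinite_def by blast
  have "h (\<alpha> i) \<otimes>\<^bsub>S\<^esub> a \<otimes>\<^bsub>S\<^esub> h (\<beta> j) = (if i = j then a else \<zero>\<^bsub>S\<^esub>)"
    if ij: "i \<in> {1, 2}" "j \<in> {1, 2}" for i j
  proof -
    have "\<alpha> i \<in> carrier R" "\<beta> j \<in> carrier R" using ab ij by blast+
    then have "h (\<alpha> i) \<otimes>\<^bsub>S\<^esub> a \<otimes>\<^bsub>S\<^esub> h (\<beta> j) = h (\<alpha> i \<otimes>\<^bsub>R\<^esub> a' \<otimes>\<^bsub>R\<^esub> \<beta> j)"
      using a' by (simp add: hom_mult R.mult_closed)
    then show ?thesis using eq[OF ij] a' by simp
  qed
  moreover have "h \<circ> \<alpha> \<in> {1, 2} \<rightarrow> carrier S" "h \<circ> \<beta> \<in> {1, 2} \<rightarrow> carrier S"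
    using ab by auto
  ultimately show "properly_infinite S a"
    using a unfolding properly_infinite_def
    by (intro conjI exI[of _ "h \<circ> \<alpha>"] exI[of _ "h \<circ> \<beta>"]) auto
qed (rule S.nonunital_ring_axioms)

end

section \<open>Ideals with local units\<close>

locale s_unital_ideal = two_sided_ideal +
  assumes s_unital: "s_unital (R\<lparr>carrier := I\<rparr>)"
begin

lemma nonunital_ring_ideal: "nonunital_ring (R\<lparr>carrier := I\<rparr>)"
  using s_unital unfolding s_unital_def by blast

lemma local_units:
  assumes "x \<in> I"
  obtains u v where "u \<in> I" "v \<in> I" "u \<otimes> x = x" "x \<otimes> v = x"
  using s_unital assms unfolding s_unital_def by auto

lemma inclusion_hom: "nonunital_ring_hom (R\<lparr>carrier := I\<rparr>) R (\<lambda>x. x)"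
  using a_subset
  by (intro nonunital_ring_homI nonunital_ring_ideal nonunital_ring_axioms) auto

text \<open>
  Multipliers from $R$ are traded for multipliers in $I$ by inserting local units of $a$, which
  $a$ absorbs.
\<close>

lemma absorb_local_units:
  assumes "x \<in> carrier R" "y \<in> carrier R" "u \<in> I" "v \<in> I" "a \<in> I" "u \<otimes> a = a" "a \<otimes> v = a"
  shows "(x \<otimes> u) \<otimes> a \<otimes> (v \<otimes> y) = x \<otimes> a \<otimes> y"
proof -
  have c: "u \<in> carrier R" "v \<in> carrier R" "a \<in> carrier R" using assms a_subset by auto
  have "(x \<otimes> u) \<otimes> a \<otimes> (v \<otimes> y) = x \<otimes> (u \<otimes> a) \<otimes> (v \<otimes> y)"
    using assms(1) c by (simp add: mult_assoc)
  also have "\<dots> = x \<otimes> (a \<otimes> v) \<otimes> y"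
    using assms(1,2,6) c by (simp add: mult_assoc mult_closed)
  finally show ?thesis using assms by simp
qed

text \<open>
  An ideal of an ideal need not be an ideal of the whole ring. Here it is: for $a \<in> J$ with
  local units $u, v \<in> I$ one has $xa = (xu)a$ and $ax = a(vx)$, where $xu$ and $vx$ lie in $I$.
\<close>

lemma ideal_of_ideal:
  assumes "two_sided_ideal J (R\<lparr>carrier := I\<rparr>)"
  shows "two_sided_ideal J R"
proof -
  interpret J: two_sided_ideal J "R\<lparr>carrier := I\<rparr>" by fact
  have JI: "J \<subseteq> I" using J.a_subset by simp
  interpret incl: nonunital_ring_hom "R\<lparr>carrier := I\<rparr>" R "\<lambda>x. x" by (rule inclusion_hom)
  have "\<ominus> a \<in> J" if "a \<in> J" for a
  proof -
    have "\<ominus>\<^bsub>R\<lparr>carrier := I\<rparr>\<^esub> a = \<ominus> a" using incl.hom_a_inv[of a] JI that by auto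
    then show ?thesis using additive_subgroup.a_inv_closed[OF J.is_additive_subgroup that]
      by simp
  qed
  moreover have "x \<otimes> a \<in> J" "a \<otimes> x \<in> J" if a: "a \<in> J" and x: "x \<in> carrier R" for a x
  proof -
    obtain u v where uv: "u \<in> I" "v \<in> I" "u \<otimes> a = a" "a \<otimes> v = a"
      using local_units a JI by blast
    have c: "u \<in> carrier R" "v \<in> carrier R" "a \<in> carrier R"
      using uv a JI a_subset by auto
    have "x \<otimes> a = (x \<otimes> u) \<otimes> a" "a \<otimes> x = a \<otimes> (v \<otimes> x)"
      using mult_assoc[of x u a] mult_assoc[of a v x] uv c x by simp_all
    then show "x \<otimes> a \<in> J" "a \<otimes> x \<in> J"
      using J.mult_left_mem[OF a, of "x \<otimes> u"] J.mult_right_mem[OF a, of "v \<otimes> x"]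
        mult_left_mem[OF uv(1) x] mult_right_mem[OF uv(2) x] by simp_all
  qed
  ultimately show ?thesis
    using additive_subgroup.a_closed[OF J.is_additive_subgroup]
      additive_subgroup.zero_closed[OF J.is_additive_subgroup] JI a_subset
    by (intro two_sided_idealI) auto
qed

end

section \<open>Extending a division ring quotient from an ideal to the ring\<close>

context two_sided_ideal
begin

lemma residual_ideal:
  assumes "two_sided_ideal J R"
  shows "two_sided_ideal {r \<in> carrier R. \<forall>k \<in> I. r \<otimes> k \<in> J} R"
proof -
  interpret J: two_sided_ideal J R by fact
  show ?thesis
    by (rule two_sided_idealI)
      (auto simp: distrib_right mult_minus_left mult_zero_left mult_closed mult_assoc
        mult_left_mem J.mult_left_mem)
qed

text \<open>
  Let $e \<in> I$ be an identity modulo $J$. For $a \<notin> K$ some $i \<in> I$ has $ai \<notin> J$, and also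
  $ae \<notin> J$, as $ai \<equiv> (ae)i$. Hence $(ai)z \<equiv> be$ and $y(ae) \<equiv> be$ are solvable in $I$ modulo $J$.
  Multiplying by any $k \<in> I$ on the right removes $e$, so $a(iz)k \<equiv> bk$ and $yak \<equiv> bk$ modulo $J$,
  which says that $iz$ and $y$ solve the two equations modulo $K$.
\<close>

lemma division_modulo_residual:
  assumes J: "two_sided_ideal J R" and JI: "two_sided_ideal J (R\<lparr>carrier := I\<rparr>)"
    and div: "division_modulo (R\<lparr>carrier := I\<rparr>) J"
  shows "division_modulo R {r \<in> carrier R. \<forall>k \<in> I. r \<otimes> k \<in> J}"
proof -
  interpret J: two_sided_ideal J R by fact
  interpret JI: two_sided_ideal J "R\<lparr>carrier := I\<rparr>" by fact
  (* K is opaque: unfolded, the simplification rule "x in K implies x in carrier R" would loop. *)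
  define K where "K = {r \<in> carrier R. \<forall>k \<in> I. r \<otimes> k \<in> J}"
  interpret K: two_sided_ideal K R unfolding K_def by (rule residual_ideal[OF J])
  have mem: "r \<in> K \<longleftrightarrow> (\<forall>k \<in> I. r \<otimes> k \<in> J)" if "r \<in> carrier R" for r
    using that unfolding K_def by blast
  have coset_simp: "J +>\<^bsub>R\<lparr>carrier := I\<rparr>\<^esub> a = J +> a" for a
    by (simp add: a_r_coset_def')
  obtain e where e: "e \<in> I" "e \<notin> J"
    and right: "\<And>b. b \<in> I \<Longrightarrow> J +> (b \<otimes> e) = J +> b"
    and left: "\<And>b. b \<in> I \<Longrightarrow> J +> (e \<otimes> b) = J +> b"
    using JI.division_modulo_identity[OF div] by (auto simp: coset_simp)
  have solve_right: "\<exists>x \<in> I. J +> (a \<otimes> x) = J +> b"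
    and solve_left: "\<exists>y \<in> I. J +> (y \<otimes> a) = J +> b"
    if "a \<in> I" "a \<notin> J" "b \<in> I" for a b
    using div that by (auto simp: division_modulo_def coset_simp)
  have ce: "e \<in> carrier R" using e by simp
  have K_coset: "K +> c = K +> d"
    if c: "c \<in> carrier R" and d: "d \<in> carrier R"
      and eq: "\<And>k. k \<in> I \<Longrightarrow> J +> (c \<otimes> k) = J +> (d \<otimes> k)" for c d
    using c d eq by (simp add: K.coset_eq_iff J.coset_eq_iff mem diff_mult mult_closed)
  have absorb: "J +> (b \<otimes> e \<otimes> k) = J +> (b \<otimes> k)" if "b \<in> carrier R" "k \<in> I" for b k
    using J.coset_mult_left[OF left[OF that(2)], of b] that ce
    by (simp add: mult_assoc mult_closed)
  show ?thesis
    unfolding division_modulo_def K_def[symmetric]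
  proof (intro conjI ballI)
    have "e \<otimes> e \<notin> J"
      using right[OF e(1)] e ce J.coset_eq_self_iff mult_closed by metis
    then have "e \<notin> K" using e mem[OF ce] by blast
    then show "\<not> carrier R \<subseteq> K" using ce by blast
  next
    fix a b assume a: "a \<in> carrier R - K" and b: "b \<in> carrier R"
    then obtain i where i: "i \<in> I" "a \<otimes> i \<notin> J" by (auto simp: mem)
    have ci: "i \<in> carrier R" and ca: "a \<in> carrier R" using i a by auto
    have be: "b \<otimes> e \<in> I" using b e mult_left_mem by blast
    obtain z where z: "z \<in> I" "J +> (a \<otimes> i \<otimes> z) = J +> (b \<otimes> e)"
      using solve_right[of "a \<otimes> i" "b \<otimes> e"] i be ca mult_left_mem by blast
    have cz: "z \<in> carrier R" using z by simp
    have "K +> (a \<otimes> (i \<otimes> z)) = K +> b"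
    proof (rule K_coset)
      fix k assume k: "k \<in> I"
      have "J +> (a \<otimes> (i \<otimes> z) \<otimes> k) = J +> (b \<otimes> e \<otimes> k)"
        using J.coset_mult_right[OF z(2), of k] k b ca ci cz ce
        by (simp add: mult_assoc mult_closed)
      then show "J +> (a \<otimes> (i \<otimes> z) \<otimes> k) = J +> (b \<otimes> k)"
        using absorb[OF b k] by simp
    qed (use ca ci cz b in \<open>auto simp: mult_closed\<close>)
    then show "\<exists>x \<in> carrier R. K +> (a \<otimes> x) = K +> b"
      using ci cz mult_closed by blast
    have "a \<otimes> e \<notin> J"
    proof
      assume "a \<otimes> e \<in> J"
      then have "a \<otimes> e \<otimes> i \<in> J" using ci J.mult_right_mem by blast
      then show False
        using absorb[OF ca i(1)] i(2) ca ci ce J.coset_eq_self_iff mult_closed by metis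
    qed
    then obtain y where y: "y \<in> I" "J +> (y \<otimes> (a \<otimes> e)) = J +> (b \<otimes> e)"
      using solve_left[of "a \<otimes> e" "b \<otimes> e"] be ca e mult_left_mem by blast
    have cy: "y \<in> carrier R" using y by simp
    have "K +> (y \<otimes> a) = K +> b"
    proof (rule K_coset)
      fix k assume k: "k \<in> I"
      have "J +> (y \<otimes> a \<otimes> k) = J +> (y \<otimes> a \<otimes> e \<otimes> k)"
        using absorb[of "y \<otimes> a" k] k cy ca mult_closed by simp
      also have "\<dots> = J +> (b \<otimes> e \<otimes> k)"
        using J.coset_mult_right[OF y(2), of k] k b ca cy ce
        by (simp add: mult_assoc mult_closed)
      finally show "J +> (y \<otimes> a \<otimes> k) = J +> (b \<otimes> k)"
        using absorb[OF b k] by simp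
    qed (use ca cy b in \<open>auto simp: mult_closed\<close>)
    then show "\<exists>y \<in> carrier R. K +> (y \<otimes> a) = K +> b"
      using cy by blast
  qed
qed

end

section \<open>Pure infiniteness of ideals with local units\<close>

context s_unital_ideal
begin

lemma purely_infinite_ideal:
  assumes R: "purely_infinite R"
  shows "purely_infinite (R\<lparr>carrier := I\<rparr>)"
  unfolding purely_infinite_def
proof (intro conjI allI impI ballI)
  fix J assume JI: "two_sided_ideal J (R\<lparr>carrier := I\<rparr>)"
  then have J: "two_sided_ideal J R" by (rule ideal_of_ideal)
  let ?K = "{r \<in> carrier R. \<forall>k \<in> I. r \<otimes> k \<in> J}"
  have K: "two_sided_ideal ?K R" by (rule residual_ideal[OF J])
  show "\<not> division_ring (R\<lparr>carrier := I\<rparr> Quot J)"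
  proof
    assume "division_ring (R\<lparr>carrier := I\<rparr> Quot J)"
    then have "division_modulo R ?K"
      using two_sided_ideal.division_ring_quotient_iff[OF JI] division_modulo_residual[OF J JI]
      by blast
    then show False
      using R K two_sided_ideal.division_ring_quotient_iff[OF K]
      unfolding purely_infinite_def by blast
  qed
next
  fix a b assume a: "a \<in> carrier (R\<lparr>carrier := I\<rparr>)" and "b \<in> RaR (R\<lparr>carrier := I\<rparr>) a"
  then have "b \<in> RaR R a"
    using nonunital_ring_hom.hom_RaR[OF inclusion_hom] by blast
  moreover have "a \<in> carrier R" using a by simp
  ultimately obtain x y where xy: "x \<in> carrier R" "y \<in> carrier R" "b = x \<otimes> a \<otimes> y"
    using R unfolding purely_infinite_def by blast
  obtain u v where uv: "u \<in> I" "v \<in> I" "u \<otimes> a = a" "a \<otimes> v = a"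
    using local_units a by auto
  have "b = (x \<otimes> u) \<otimes> a \<otimes> (v \<otimes> y)" "x \<otimes> u \<in> I" "v \<otimes> y \<in> I"
    using absorb_local_units[OF xy(1,2) uv(1,2) _ uv(3,4)] a xy uv mult_left_mem mult_right_mem
    by simp_all
  then show "\<exists>x \<in> carrier (R\<lparr>carrier := I\<rparr>). \<exists>y \<in> carrier (R\<lparr>carrier := I\<rparr>).
      b = x \<otimes>\<^bsub>R\<lparr>carrier := I\<rparr>\<^esub> a \<otimes>\<^bsub>R\<lparr>carrier := I\<rparr>\<^esub> y"
    by auto
qed (rule nonunital_ring_ideal)

lemma properly_purely_infinite_ideal:
  assumes R: "properly_purely_infinite R"
  shows "properly_purely_infinite (R\<lparr>carrier := I\<rparr>)"
  unfolding properly_purely_infinite_def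
proof (intro conjI ballI)
  fix a assume a: "a \<in> carrier (R\<lparr>carrier := I\<rparr>) - {\<zero>\<^bsub>R\<lparr>carrier := I\<rparr>\<^esub>}"
  then have aI: "a \<in> I" "a \<noteq> \<zero>" by auto
  then have "properly_infinite R a"
    using R unfolding properly_purely_infinite_def by auto
  then obtain \<alpha> \<beta> where ab: "\<alpha> \<in> {1, 2 :: nat} \<rightarrow> carrier R" "\<beta> \<in> {1, 2 :: nat} \<rightarrow> carrier R"
    and eq: "\<And>i j. \<lbrakk>i \<in> {1, 2}; j \<in> {1, 2}\<rbrakk> \<Longrightarrow>
      \<alpha> i \<otimes> a \<otimes> \<beta> j = (if i = j then a else \<zero>)"
    unfolding properly_infinite_def by blast
  obtain u v where uv: "u \<in> I" "v \<in> I" "u \<otimes> a = a" "a \<otimes> v = a"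
    using local_units aI by blast
  have "(\<alpha> i \<otimes> u) \<otimes> a \<otimes> (v \<otimes> \<beta> j) = (if i = j then a else \<zero>)"
    if ij: "i \<in> {1, 2}" "j \<in> {1, 2}" for i j
  proof -
    have "\<alpha> i \<in> carrier R" "\<beta> j \<in> carrier R" using ab ij by blast+
    then show ?thesis
      using absorb_local_units[OF _ _ uv(1,2) aI(1) uv(3,4)] eq[OF ij] by simp
  qed
  moreover have "(\<lambda>i. \<alpha> i \<otimes> u) \<in> {1, 2} \<rightarrow> I" "(\<lambda>j. v \<otimes> \<beta> j) \<in> {1, 2} \<rightarrow> I"
    using ab uv mult_left_mem mult_right_mem by (auto simp: Pi_iff)
  ultimately show "properly_infinite (R\<lparr>carrier := I\<rparr>) a"
    using aI unfolding properly_infinite_def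
    by (intro conjI exI[of _ "\<lambda>i. \<alpha> i \<otimes> u"] exI[of _ "\<lambda>j. v \<otimes> \<beta> j"]) simp_all
qed (rule nonunital_ring_ideal)

end

theorem lemma3p7:
  fixes R :: "('a, 'm) ring_scheme" and I :: "'a set"
  assumes "nonunital_ring R" and "two_sided_ideal I R"
  shows "(purely_infinite R \<longrightarrow> purely_infinite (R Quot I)) \<and>
    (properly_purely_infinite R \<longrightarrow> properly_purely_infinite (R Quot I)) \<and>
    (s_unital (R\<lparr>carrier := I\<rparr>) \<longrightarrow>
      (purely_infinite R \<longrightarrow> purely_infinite (R\<lparr>carrier := I\<rparr>)) \<and>
      (properly_purely_infinite R \<longrightarrow> properly_purely_infinite (R\<lparr>carrier := I\<rparr>)))"
proof -
  interpret two_sided_ideal I R by fact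
  interpret h: nonunital_ring_hom R "R Quot I" "(+>\<^bsub>R\<^esub>) I" by (rule coset_hom)
  have "s_unital_ideal I R" if "s_unital (R\<lparr>carrier := I\<rparr>)"
    using that by unfold_locales
  then show ?thesis
    using h.purely_infinite_image[OF coset_image] h.properly_purely_infinite_image[OF coset_image]
      s_unital_ideal.purely_infinite_ideal s_unital_ideal.properly_purely_infinite_ideal
    by blast
qed

end
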